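(* Let $w^d$ and $w^o$ be the collected trajectories described in the context, and assume $\operatorname{rank}(H_{T_{\mathrm{ini}}+N}(w^d))=m(T_{\mathrm{ini}}+N)+n$. Suppose two pairs of symmetric positive definite weighting matrices $(Q,R)$ and $(Q',R')$, with $Q,Q'\in\mathbb{R}^{p\times p}$ and $R,R'\in\mathbb{R}^{m\times m}$, both satisfy (each with some corresponding vector $\lambda_{\mathrm{ini}}\in\mathbb{R}^{(m+p)T_{\mathrm{ini}}}$) the equation $$w_p^T\lambda_{\mathrm{ini}}+2U_f^T\mathcal{R}\tilde u+2Y_f^T\mathcal{Q}\tilde y=0,$$ where $\mathcal{Q}=\operatorname{diag}(Q,\dots,Q)$ and $\mathcal{R}=\operatorname{diag}(R,\dots,R)$ ($N$ diagonal blocks each; for the second pair $Q,R$ are replaced by $Q',R'$). If $\dim(\mathbb{N}(\tilde\Psi))=1$, where $\mathbb{N}(\cdot)$ denotes the null space, then $Q=\alpha Q'$ and $R=\alpha R'$ for some scalar $\alpha>0$.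
   Context: System: $x_{k+1}=Ax_k+Bu_k$, $y_k=Cx_k+Du_k$ is a minimal LTI system with state dimension $n$, input dimension $m$, output dimension $p$. $\operatorname{col}(\cdot)$ denotes vertical stacking, $\operatorname{diag}$ of matrices the block diagonal matrix, $\otimes$ the Kronecker product, $M(a:b,:)$ the submatrix of rows $a$ to $b$ of $M$. Offline data: $w^d=\{u^d_k,y^d_k\}_{k=0}^{T-1}$ is an input-output trajectory of the system. For a signal $v=\{v_k\}_{k=0}^{T-1}$ the Hankel matrix $\mathcal{H}_L(v)$ has $L$ block rows and $T-L+1$ columns, with $(i,j)$ block $v_{i+j}$ ($0\le i\le L-1$, $0\le j\le T-L$). Partition $\operatorname{col}(U_p,U_f)=\mathcal{H}_{T_{\mathrm{ini}}+N}(u^d)$ and $\operatorname{col}(Y_p,Y_f)=\mathcal{H}_{T_{\mathrm{ini}}+N}(y^d)$, where $U_p,Y_p$ consist of the first $T_{\mathrm{ini}}$ block rows and $U_f,Y_f$ of the last $N$ block rows. $H_{T_{\mathrm{ini}}+N}(w^d)=\operatorname{col}(U_p,Y_p,U_f,Y_f)$ and $w_p=\operatorname{col}(U_p,Y_p)$. Optimal data: $w^o$ is an input-output trajectory of length $N'=T_{\mathrm{ini}}+N$, optimal for minimizing $\sum_{k=0}^{N'-1}(y_k^TQ_0y_k+u_k^TR_0u_k)$ subject to the system dynamics with a given initial state, where $Q_0,R_0$ are the (unknown) true positive definite weights. Its last $N$ samples have stacked inputs $\tilde u=\operatorname{col}(\tilde u_0,\dots,\tilde u_{N-1})$ and outputs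 $\tilde y=\operatorname{col}(\tilde y_0,\dots,\tilde y_{N-1})$. $\operatorname{vec}$ is column-stacking vectorization and $\operatorname{vech}$ half-vectorization of symmetric matrices. $D_m,D_p$ are the duplication matrices: $D_m\operatorname{vech}(R)=\operatorname{vec}(R)$ and $D_p\operatorname{vech}(Q)=\operatorname{vec}(Q)$ for all symmetric $R\in\mathbb{R}^{m\times m}$, $Q\in\mathbb{R}^{p\times p}$. Then $$\tilde\Psi=\begin{pmatrix}w_p^T&\tilde U_f&\tilde Y_f\end{pmatrix}\operatorname{diag}(I,D_m,D_p),$$ $$\tilde U_f=\sum_{i=0}^{N-1}\tilde u_i^T\otimes 2\big(U_f(im+1:(i+1)m,:)\big)^T,\qquad \tilde Y_f=\sum_{i=0}^{N-1}\tilde y_i^T\otimes2\big(Y_f(ip+1:(i+1)p,:)\big)^T,$$ where $I$ is the identity of size $(m+p)T_{\mathrm{ini}}$. *)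

theory Defs
  imports "Jordan_Normal_Form.Matrix_Kernel" "Jordan_Normal_Form.DL_Rank"
begin

section \<open>Matrix operations\<close>

definition append_cols :: "'a::zero mat \<Rightarrow> 'a mat \<Rightarrow> 'a mat" (infixr \<open>@\<^sub>c\<close> 65) where
  "A @\<^sub>c B = four_block_mat A B (0\<^sub>m 0 (dim_col A)) (0\<^sub>m 0 (dim_col B))"

text \<open>Rows \<open>a, \<dots>, b - 1\<close> of \<open>M\<close>, counted from 0; in one-based notation \<open>M(a+1 : b, :)\<close>.\<close>
definition row_range :: "'a mat \<Rightarrow> nat \<Rightarrow> nat \<Rightarrow> 'a mat" where
  "row_range M a b = mat_of_rows (dim_col M) (map (row M) [a..<b])"

definition kronecker :: "'a::times mat \<Rightarrow> 'a mat \<Rightarrow> 'a mat" (infixl \<open>\<otimes>\<^sub>k\<close> 70) where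
  "A \<otimes>\<^sub>k B = mat (dim_row A * dim_row B) (dim_col A * dim_col B)
     (\<lambda>(i, j). A $$ (i div dim_row B, j div dim_col B) * B $$ (i mod dim_row B, j mod dim_col B))"

text \<open>The dimensions are explicit so that empty sums are defined as well.\<close>
definition mat_sum :: "nat \<Rightarrow> nat \<Rightarrow> ('i \<Rightarrow> 'a::comm_monoid_add mat) \<Rightarrow> 'i set \<Rightarrow> 'a mat" where
  "mat_sum nr nc F I = mat nr nc (\<lambda>ij. \<Sum>i\<in>I. F i $$ ij)"

abbreviation mat_rank :: "real mat \<Rightarrow> nat" where
  "mat_rank M \<equiv> vec_space.rank (dim_row M) M"

definition pos_def :: "nat \<Rightarrow> real mat \<Rightarrow> bool" where
  "pos_def k M \<longleftrightarrow> M \<in> carrier_mat k k \<and> M\<^sup>T = M \<and>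
     (\<forall>x \<in> carrier_vec k. x \<noteq> 0\<^sub>v k \<longrightarrow> x \<bullet> (M *\<^sub>v x) > 0)"

text \<open>Column-stacking vectorization and half-vectorization; the latter stacks, column by column,
  the entries on and below the diagonal.\<close>
definition vectorize :: "'a mat \<Rightarrow> 'a vec" where
  "vectorize M = vec (dim_row M * dim_col M) (\<lambda>k. M $$ (k mod dim_row M, k div dim_row M))"

definition vech_indices :: "nat \<Rightarrow> (nat \<times> nat) list" where
  "vech_indices k = concat (map (\<lambda>j. map (\<lambda>i. (i, j)) [j..<k]) [0..<k])"

definition vech :: "'a mat \<Rightarrow> 'a vec" where
  "vech M = vec_of_list (map (\<lambda>ij. M $$ ij) (vech_indices (dim_row M)))"

definition duplication_mat :: "nat \<Rightarrow> real mat \<Rightarrow> bool" where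
  "duplication_mat k D \<longleftrightarrow> D \<in> carrier_mat (k * k) (k * (k + 1) div 2) \<and>
     (\<forall>S \<in> carrier_mat k k. S\<^sup>T = S \<longrightarrow> D *\<^sub>v vech S = vectorize S)"

lemma vech_indices_props:
  "length (vech_indices k) = k * (k + 1) div 2"
  "distinct (vech_indices k)"
  "set (vech_indices k) = {(i, j). j \<le> i \<and> i < k}"
proof -
  have sum_eq: "(\<Sum>j<n. k - j) = n * k - n * (n - 1) div 2" if "n \<le> k" for n
  proof -
    have "2 * (\<Sum>j<n. k - j) + n * (n - 1) = 2 * (n * k)"
      using that
    proof (induction n)
      case (Suc n)
      then obtain d where d: "k = Suc n + d" using le_Suc_ex by blast
      from Suc have "2 * (\<Sum>j<n. k - j) + n * (n - 1) = 2 * (n * k)" by simp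
      then show ?case using d by (cases n) (auto simp: algebra_simps)
    qed simp
    then show ?thesis by presburger
  qed
  have "length (vech_indices k) = (\<Sum>j<k. k - j)"
    by (simp add: vech_indices_def length_concat comp_def interv_sum_list_conv_sum_set_nat
        atLeast0LessThan)
  also have "\<dots> = k * (k + 1) div 2"
  proof -
    have "k * k + (k * (k - 1)) div 2 * 0 - k * (k - 1) div 2 = k * (k + 1) div 2"
    proof (cases k)
      case (Suc l)
      have "even (l * Suc l)" by simp
      then obtain c where "l * Suc l = 2 * c" by blast
      then show ?thesis using Suc by (auto simp: algebra_simps)
    qed simp
    then show ?thesis using sum_eq[of k] by simp
  qed
  finally show "length (vech_indices k) = k * (k + 1) div 2" .
  show "set (vech_indices k) = {(i, j). j \<le> i \<and> i < k}"
    by (force simp: vech_indices_def)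
  have "distinct (concat (map (\<lambda>j. map (\<lambda>i. (i, j)) [j..<k]) [0..<n]))" for n
    by (induction n) (auto simp: distinct_map inj_on_def)
  then show "distinct (vech_indices k)" by (simp add: vech_indices_def)
qed

lemma duplication_mat_exists: "\<exists>D. duplication_mat k D"
proof -
  let ?l = "vech_indices k"
  let ?n = "k * (k + 1) div 2"
  let ?pos = "\<lambda>r. (max (r mod k) (r div k), min (r mod k) (r div k))"
  define D :: "real mat" where
    "D = mat (k * k) ?n (\<lambda>(r, s). if ?l ! s = ?pos r then 1 else 0)"
  have "D *\<^sub>v vech S = vectorize S" if S: "S \<in> carrier_mat k k" "S\<^sup>T = S" for S :: "real mat"
  proof (rule eq_vecI)
    fix r assume "r < dim_vec (vectorize S)"
    then have r: "r < k * k" using S by (simp add: vectorize_def)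
    then have k: "k > 0" by (cases k) auto
    have lt: "r mod k < k" "r div k < k" using r k by (auto simp: less_mult_imp_div_less)
    then have "?pos r \<in> set ?l" by (auto simp: vech_indices_props)
    then obtain t where t: "t < ?n" "?l ! t = ?pos r"
      by (metis in_set_conv_nth vech_indices_props(1))
    have inj: "?l ! s = ?pos r \<longleftrightarrow> s = t" if "s < ?n" for s
      using that t nth_eq_iff_index_eq[OF vech_indices_props(2)] vech_indices_props(1) by metis
    have "(D *\<^sub>v vech S) $ r = (\<Sum>s<?n. D $$ (r, s) * vech S $ s)"
      using r S by (auto simp: D_def scalar_prod_def vech_def vech_indices_props atLeast0LessThan
          intro!: sum.cong)
    also have "\<dots> = (\<Sum>s<?n. if s = t then S $$ (?l ! s) else 0)"
      using r S inj by (intro sum.cong) (auto simp: D_def vech_def vech_indices_props vec_of_list_index)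
    also have "\<dots> = S $$ ?pos r" using t by simp
    also have "\<dots> = S $$ (r mod k, r div k)"
    proof -
      have "S $$ (r mod k, r div k) = S\<^sup>T $$ (r mod k, r div k)" using S by simp
      also have "\<dots> = S $$ (r div k, r mod k)" using S(1) lt k by simp
      finally show ?thesis by (auto simp: max_def min_def)
    qed
    finally show "(D *\<^sub>v vech S) $ r = vectorize S $ r" using r S by (simp add: vectorize_def)
  qed (use S in \<open>auto simp: D_def vectorize_def\<close>)
  then have "duplication_mat k D" unfolding duplication_mat_def by (simp add: D_def)
  then show ?thesis by blast
qed


section \<open>Linear time-invariant systems\<close>

text \<open>Signals are functions on \<open>nat\<close>, of which only the samples \<open>0, \<dots>, T - 1\<close> are relevant for a
  trajectory of length \<open>T\<close>.\<close>

definition lti_system ::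
  "nat \<Rightarrow> nat \<Rightarrow> nat \<Rightarrow> real mat \<Rightarrow> real mat \<Rightarrow> real mat \<Rightarrow> real mat \<Rightarrow> bool" where
  "lti_system n m p A B C D \<longleftrightarrow> A \<in> carrier_mat n n \<and> B \<in> carrier_mat n m \<and>
     C \<in> carrier_mat p n \<and> D \<in> carrier_mat p m"

definition trajectory_from ::
  "real mat \<Rightarrow> real mat \<Rightarrow> real mat \<Rightarrow> real mat \<Rightarrow> real vec \<Rightarrow> nat \<Rightarrow>
   (nat \<Rightarrow> real vec) \<Rightarrow> (nat \<Rightarrow> real vec) \<Rightarrow> bool" where
  "trajectory_from A B C D x0 T u y \<longleftrightarrow>
     (\<forall>k<T. u k \<in> carrier_vec (dim_col B)) \<and>
     (\<exists>x. x 0 = x0 \<and>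
        (\<forall>k<T. x (Suc k) = A *\<^sub>v x k + B *\<^sub>v u k \<and> y k = C *\<^sub>v x k + D *\<^sub>v u k))"

definition io_trajectory ::
  "real mat \<Rightarrow> real mat \<Rightarrow> real mat \<Rightarrow> real mat \<Rightarrow> nat \<Rightarrow>
   (nat \<Rightarrow> real vec) \<Rightarrow> (nat \<Rightarrow> real vec) \<Rightarrow> bool" where
  "io_trajectory A B C D T u y \<longleftrightarrow>
     (\<exists>x0 \<in> carrier_vec (dim_row A). trajectory_from A B C D x0 T u y)"

text \<open>A minimal system has the least state dimension among all systems with the same
  (zero-initial-state) input-output map, i.e. with the same transfer function.\<close>
definition minimal_lti ::
  "nat \<Rightarrow> nat \<Rightarrow> nat \<Rightarrow> real mat \<Rightarrow> real mat \<Rightarrow> real mat \<Rightarrow> real mat \<Rightarrow> bool" where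
  "minimal_lti n m p A B C D \<longleftrightarrow> lti_system n m p A B C D \<and>
     (\<forall>n' A' B' C' D'. lti_system n' m p A' B' C' D' \<longrightarrow>
        (\<forall>T u y. trajectory_from A B C D (0\<^sub>v n) T u y \<longleftrightarrow>
                 trajectory_from A' B' C' D' (0\<^sub>v n') T u y) \<longrightarrow> n \<le> n')"

definition lq_cost ::
  "nat \<Rightarrow> real mat \<Rightarrow> real mat \<Rightarrow> (nat \<Rightarrow> real vec) \<Rightarrow> (nat \<Rightarrow> real vec) \<Rightarrow> real" where
  "lq_cost T Q R u y = (\<Sum>k<T. y k \<bullet> (Q *\<^sub>v y k) + u k \<bullet> (R *\<^sub>v u k))"

definition lq_optimal ::
  "real mat \<Rightarrow> real mat \<Rightarrow> real mat \<Rightarrow> real mat \<Rightarrow> real vec \<Rightarrow> nat \<Rightarrow> real mat \<Rightarrow> real mat \<Rightarrow>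
   (nat \<Rightarrow> real vec) \<Rightarrow> (nat \<Rightarrow> real vec) \<Rightarrow> bool" where
  "lq_optimal A B C D x0 T Q R u y \<longleftrightarrow> trajectory_from A B C D x0 T u y \<and>
     (\<forall>u' y'. trajectory_from A B C D x0 T u' y' \<longrightarrow> lq_cost T Q R u y \<le> lq_cost T Q R u' y')"


section \<open>Data matrices\<close>

text \<open>Below, \<open>q\<close> is the dimension of the samples of a signal and \<open>T\<close> the number of its samples.\<close>

definition hankel :: "nat \<Rightarrow> nat \<Rightarrow> nat \<Rightarrow> (nat \<Rightarrow> real vec) \<Rightarrow> real mat" where
  "hankel q L T v = mat (L * q) (T - L + 1) (\<lambda>(r, j). v (r div q + j) $ (r mod q))"

definition past_rows :: "nat \<Rightarrow> nat \<Rightarrow> nat \<Rightarrow> nat \<Rightarrow> (nat \<Rightarrow> real vec) \<Rightarrow> real mat" where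
  "past_rows q Tini N T v = row_range (hankel q (Tini + N) T v) 0 (Tini * q)"

definition future_rows :: "nat \<Rightarrow> nat \<Rightarrow> nat \<Rightarrow> nat \<Rightarrow> (nat \<Rightarrow> real vec) \<Rightarrow> real mat" where
  "future_rows q Tini N T v = row_range (hankel q (Tini + N) T v) (Tini * q) ((Tini + N) * q)"

definition past_data ::
  "nat \<Rightarrow> nat \<Rightarrow> nat \<Rightarrow> nat \<Rightarrow> nat \<Rightarrow> (nat \<Rightarrow> real vec) \<Rightarrow> (nat \<Rightarrow> real vec) \<Rightarrow> real mat" where
  "past_data m p Tini N T u y = past_rows m Tini N T u @\<^sub>r past_rows p Tini N T y"

definition data_matrix ::
  "nat \<Rightarrow> nat \<Rightarrow> nat \<Rightarrow> nat \<Rightarrow> nat \<Rightarrow> (nat \<Rightarrow> real vec) \<Rightarrow> (nat \<Rightarrow> real vec) \<Rightarrow> real mat" where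
  "data_matrix m p Tini N T u y =
     past_rows m Tini N T u @\<^sub>r past_rows p Tini N T y @\<^sub>r
     future_rows m Tini N T u @\<^sub>r future_rows p Tini N T y"

definition stack :: "nat \<Rightarrow> nat \<Rightarrow> (nat \<Rightarrow> 'a vec) \<Rightarrow> 'a vec" where
  "stack q N v = vec (N * q) (\<lambda>k. v (k div q) $ (k mod q))"

text \<open>For \<open>F\<close> with \<open>N\<close> block rows of height \<open>q\<close>, this is
  \<open>\<Sum>\<^sub>i\<^sub><\<^sub>N v\<^sub>i\<^sup>T \<otimes> 2 (F(iq+1 : (i+1)q, :))\<^sup>T\<close>.\<close>
definition kron_data :: "nat \<Rightarrow> nat \<Rightarrow> real mat \<Rightarrow> (nat \<Rightarrow> real vec) \<Rightarrow> real mat" where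
  "kron_data q N F v = mat_sum (dim_col F) (q * q)
     (\<lambda>i. mat_of_row (v i) \<otimes>\<^sub>k (2 \<cdot>\<^sub>m (row_range F (i * q) ((i + 1) * q))\<^sup>T)) {..<N}"

definition Psi_tilde ::
  "nat \<Rightarrow> nat \<Rightarrow> nat \<Rightarrow> nat \<Rightarrow> nat \<Rightarrow> (nat \<Rightarrow> real vec) \<Rightarrow> (nat \<Rightarrow> real vec) \<Rightarrow>
   (nat \<Rightarrow> real vec) \<Rightarrow> (nat \<Rightarrow> real vec) \<Rightarrow> real mat \<Rightarrow> real mat \<Rightarrow> real mat" where
  "Psi_tilde m p Tini N T ud yd ut yt Dm Dp =
     ((past_data m p Tini N T ud yd)\<^sup>T @\<^sub>c
      kron_data m N (future_rows m Tini N T ud) ut @\<^sub>c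
      kron_data p N (future_rows p Tini N T yd) yt) *
     diag_block_mat [1\<^sub>m ((m + p) * Tini), Dm, Dp]"

definition optimality_equation ::
  "nat \<Rightarrow> nat \<Rightarrow> nat \<Rightarrow> nat \<Rightarrow> nat \<Rightarrow> (nat \<Rightarrow> real vec) \<Rightarrow> (nat \<Rightarrow> real vec) \<Rightarrow>
   (nat \<Rightarrow> real vec) \<Rightarrow> (nat \<Rightarrow> real vec) \<Rightarrow> real mat \<Rightarrow> real mat \<Rightarrow> real vec \<Rightarrow> bool" where
  "optimality_equation m p Tini N T ud yd ut yt Q R lam \<longleftrightarrow>
     (past_data m p Tini N T ud yd)\<^sup>T *\<^sub>v lam
     + 2 \<cdot>\<^sub>v ((future_rows m Tini N T ud)\<^sup>T *\<^sub>v (diag_block_mat (replicate N R) *\<^sub>v stack m N ut))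
     + 2 \<cdot>\<^sub>v ((future_rows p Tini N T yd)\<^sup>T *\<^sub>v (diag_block_mat (replicate N Q) *\<^sub>v stack p N yt))
     = 0\<^sub>v (T - (Tini + N) + 1)"

end

theory Submission
  imports Defs
begin

text \<open>The optimality equation is linear in the multiplier and in the two weights.  Column-stacking
  turns each product of a weight with a sample into a Kronecker product acting on the vectorized
  weight, \<open>F\<^sup>T S v = (v\<^sup>T \<otimes> F\<^sup>T) vec S\<close> (\<open>kron_data_mult_vectorize\<close>), and the duplication matrices
  recover \<open>vec S\<close> from \<open>vech S\<close>.  The left-hand side of the equation is therefore \<open>\<Psi>\<close>, the matrix
  \<open>Psi_tilde\<close>, applied to \<open>z = col(\<lambda>, vech R, vech Q)\<close> (\<open>Psi_tilde_mult_vec\<close>), so both pairs of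
  weights give vectors \<open>z\<close> and \<open>z'\<close> in the null space of \<open>\<Psi>\<close>.

  A positive definite weight of positive size is not zero, so \<open>z' \<noteq> 0\<close> unless \<open>m = p = 0\<close>.  Since the
  null space is a line, \<open>z = \<alpha> z'\<close> for some \<open>\<alpha>\<close> (\<open>kernel_dim_one_imp_parallel\<close>).  The half-vectorization
  determines a symmetric matrix, so the weights themselves are proportional with the common factor \<open>\<alpha>\<close>
  (\<open>vech_eq_smult_imp_eq_smult\<close>), and definiteness of both sides forces \<open>\<alpha> > 0\<close>
  (\<open>pos_def_smult_imp_pos\<close>).\<close>

section \<open>Block matrices and stacked vectors\<close>

lemma block_index_less:
  fixes i j N q :: nat
  assumes "i < N" "j < q"
  shows "i * q + j < N * q"
proof -
  have "i * q + j < Suc i * q" using assms(2) by simp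
  also have "\<dots> \<le> N * q" using assms(1) by (intro mult_le_mono1) simp
  finally show ?thesis .
qed

lemma sum_blocks:
  fixes f :: "nat \<Rightarrow> 'a::comm_monoid_add"
  shows "(\<Sum>k<N * q. f k) = (\<Sum>i<N. \<Sum>j<q. f (i * q + j))"
proof -
  have "(\<Sum>i<N. \<Sum>j<q. f (i * q + j)) = (\<Sum>i<N. sum f {i * q..<i * q + q})"
    using sum.shift_bounds_nat_ivl[of f 0 "_ * q" q]
    by (intro sum.cong[OF refl]) (simp add: atLeast0LessThan add.commute)
  then show ?thesis by (simp add: sum.nat_group)
qed

lemma smult_append_vec:
  fixes a :: "'a::times"
  shows "a \<cdot>\<^sub>v (v @\<^sub>v w) = a \<cdot>\<^sub>v v @\<^sub>v a \<cdot>\<^sub>v w"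
proof (rule eq_vecI)
  fix i assume "i < dim_vec (a \<cdot>\<^sub>v v @\<^sub>v a \<cdot>\<^sub>v w)"
  then have "i < dim_vec v + dim_vec w" by simp
  then show "(a \<cdot>\<^sub>v (v @\<^sub>v w)) $ i = (a \<cdot>\<^sub>v v @\<^sub>v a \<cdot>\<^sub>v w) $ i"
    by (cases "i < dim_vec v") simp_all
qed simp

lemma append_cols_carrier:
  assumes "A \<in> carrier_mat nr nc1" "B \<in> carrier_mat nr nc2"
  shows "A @\<^sub>c B \<in> carrier_mat nr (nc1 + nc2)"
  using assms by (auto simp: append_cols_def)

lemma append_cols_mult_vec:
  fixes A B :: "'a::comm_semiring_0 mat"
  assumes "A \<in> carrier_mat nr nc1" "B \<in> carrier_mat nr nc2"
    and "a \<in> carrier_vec nc1" "b \<in> carrier_vec nc2"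
  shows "(A @\<^sub>c B) *\<^sub>v (a @\<^sub>v b) = A *\<^sub>v a + B *\<^sub>v b"
proof -
  have "(A @\<^sub>c B) *\<^sub>v (a @\<^sub>v b) =
    (A *\<^sub>v a + B *\<^sub>v b) @\<^sub>v (0\<^sub>m 0 nc1 *\<^sub>v a + 0\<^sub>m 0 nc2 *\<^sub>v b)"
    unfolding append_cols_def using assms by (subst four_block_mat_mult_vec) auto
  then show ?thesis by auto
qed

lemma diag_block_mat_Cons_mult_vec:
  assumes A: "A \<in> carrier_mat nr nc" and As: "diag_block_mat As \<in> carrier_mat nrs ncs"
    and a: "a \<in> carrier_vec nc" and b: "b \<in> carrier_vec ncs"
  shows "diag_block_mat (A # As) *\<^sub>v (a @\<^sub>v b) = A *\<^sub>v a @\<^sub>v (diag_block_mat As *\<^sub>v b)"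
proof -
  let ?B = "diag_block_mat As"
  have "diag_block_mat (A # As) *\<^sub>v (a @\<^sub>v b) =
    (A *\<^sub>v a + 0\<^sub>m nr ncs *\<^sub>v b) @\<^sub>v (0\<^sub>m nrs nc *\<^sub>v a + ?B *\<^sub>v b)"
    using A As four_block_mat_mult_vec[OF A zero_carrier_mat zero_carrier_mat As a b]
    by (simp add: Let_def)
  also have "\<dots> = A *\<^sub>v a @\<^sub>v (?B *\<^sub>v b)" using assms by auto
  finally show ?thesis .
qed

lemma stack_Suc:
  assumes "v 0 \<in> carrier_vec q"
  shows "stack q (Suc N) v = v 0 @\<^sub>v stack q N (\<lambda>i. v (Suc i))"
proof (rule eq_vecI)
  fix k assume k: "k < dim_vec (v 0 @\<^sub>v stack q N (\<lambda>i. v (Suc i)))"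
  show "stack q (Suc N) v $ k = (v 0 @\<^sub>v stack q N (\<lambda>i. v (Suc i))) $ k"
  proof (cases "k < q")
    case False
    moreover from False k assms have "q > 0" by (cases q) (auto simp: stack_def)
    ultimately have "k div q = Suc ((k - q) div q)" "k mod q = (k - q) mod q"
      by (simp_all add: le_div_geq le_mod_geq)
    then show ?thesis using False k assms by (auto simp: stack_def)
  qed (use k assms in \<open>auto simp: stack_def\<close>)
qed (use assms in \<open>auto simp: stack_def\<close>)

lemma diag_block_mat_replicate_mult_stack:
  fixes S :: "'a::semiring_0 mat"
  assumes "S \<in> carrier_mat q q" "\<And>i. i < N \<Longrightarrow> v i \<in> carrier_vec q"
  shows "diag_block_mat (replicate N S) *\<^sub>v stack q N v = stack q N (\<lambda>i. S *\<^sub>v v i)"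
  using assms(2)
proof (induction N arbitrary: v)
  case 0
  then show ?case by (auto simp: stack_def)
next
  case (Suc N)
  have dim: "stack q N w \<in> carrier_vec (dim_col (diag_block_mat (replicate N S)))" for w :: "nat \<Rightarrow> 'a vec"
    using assms(1) by (auto simp: stack_def dim_diag_block_mat sum_list_replicate)
  have "diag_block_mat (replicate (Suc N) S) *\<^sub>v stack q (Suc N) v =
    S *\<^sub>v v 0 @\<^sub>v (diag_block_mat (replicate N S) *\<^sub>v stack q N (\<lambda>i. v (Suc i)))"
    unfolding stack_Suc[of v q N, OF Suc.prems[OF zero_less_Suc]] replicate_Suc
    using Suc.prems[of 0] assms(1) dim
    by (intro diag_block_mat_Cons_mult_vec[OF assms(1) carrier_matI[OF refl refl]]) auto
  also have "\<dots> = S *\<^sub>v v 0 @\<^sub>v stack q N (\<lambda>i. S *\<^sub>v v (Suc i))"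
    using Suc.IH[of "\<lambda>i. v (Suc i)"] Suc.prems by simp
  also have "\<dots> = stack q (Suc N) (\<lambda>i. S *\<^sub>v v i)"
    using assms(1) Suc.prems[of 0] by (subst stack_Suc) auto
  finally show ?case .
qed

section \<open>The Kronecker form of the weighted data\<close>

lemma kron_data_carrier:
  "F \<in> carrier_mat nr nc \<Longrightarrow> kron_data q N F v \<in> carrier_mat nc (q * q)"
  by (auto simp: kron_data_def mat_sum_def)

text \<open>Column \<open>b * q + a\<close> multiplies the entry of \<open>vectorize S\<close> that equals \<open>S $$ (a, b)\<close>, which is
  why the sample contributes its component \<open>b\<close> and the data block its row \<open>a\<close>.\<close>

lemma kron_data_index:
  assumes F: "F \<in> carrier_mat (N * q) nc" and v: "\<And>i. i < N \<Longrightarrow> v i \<in> carrier_vec q"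
    and r: "r < nc" and a: "a < q" and b: "b < q"
  shows "kron_data q N F v $$ (r, b * q + a) = (\<Sum>i<N. v i $ b * (2 * F $$ (i * q + a, r)))"
proof -
  have lt: "b * q + a < q * q"
    using b a by (rule block_index_less)
  have "(mat_of_row (v i) \<otimes>\<^sub>k (2 \<cdot>\<^sub>m (row_range F (i * q) ((i + 1) * q))\<^sup>T)) $$ (r, b * q + a)
      = v i $ b * (2 * F $$ (i * q + a, r))" if i: "i < N" for i
  proof -
    have "i * q + a < N * q"
      using i a by (rule block_index_less)
    then show ?thesis
      using F v[OF i] r a b lt
      by (auto simp: kronecker_def row_range_def mat_of_rows_index)
  qed
  then show ?thesis using F r lt by (simp add: kron_data_def mat_sum_def)
qed

text \<open>The identity \<open>(v\<^sup>T \<otimes> F\<^sup>T) vec S = F\<^sup>T S v\<close>, summed over the samples: entry by entry, both sides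
  are the triple sum of \<open>2 F(iq+a, r) S(a, b) v\<^sub>i(b)\<close> over \<open>i\<close>, \<open>a\<close> and \<open>b\<close>.  It makes the unknown weight
  the argument of a matrix that is known from data.\<close>

lemma kron_data_mult_vectorize:
  assumes F: "F \<in> carrier_mat (N * q) nc" and v: "\<And>i. i < N \<Longrightarrow> v i \<in> carrier_vec q"
    and S: "S \<in> carrier_mat q q"
  shows "kron_data q N F v *\<^sub>v vectorize S =
    2 \<cdot>\<^sub>v (F\<^sup>T *\<^sub>v (diag_block_mat (replicate N S) *\<^sub>v stack q N v))"
proof (rule eq_vecI)
  fix r assume "r < dim_vec (2 \<cdot>\<^sub>v (F\<^sup>T *\<^sub>v (diag_block_mat (replicate N S) *\<^sub>v stack q N v)))"
  then have r: "r < nc" using F by simp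
  let ?K = "kron_data q N F v"
  have K: "?K \<in> carrier_mat nc (q * q)" using F by (rule kron_data_carrier)
  have "(?K *\<^sub>v vectorize S) $ r = (\<Sum>k<q * q. ?K $$ (r, k) * vectorize S $ k)"
    using K r S by (auto simp: scalar_prod_def vectorize_def atLeast0LessThan)
  also have "\<dots> = (\<Sum>b<q. \<Sum>a<q. ?K $$ (r, b * q + a) * S $$ (a, b))"
    unfolding sum_blocks
  proof (intro sum.cong refl)
    fix a b assume "a \<in> {..<q}" "b \<in> {..<q}"
    moreover from this have "b * q + a < q * q"
      by (simp add: block_index_less)
    ultimately show "?K $$ (r, b * q + a) * vectorize S $ (b * q + a) =
      ?K $$ (r, b * q + a) * S $$ (a, b)"
      using S by (simp add: vectorize_def)
  qed
  also have "\<dots> = (\<Sum>b<q. \<Sum>a<q. \<Sum>i<N. 2 * (F $$ (i * q + a, r) * (S $$ (a, b) * v i $ b)))"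
    using kron_data_index[OF F v r]
    by (intro sum.cong refl) (simp add: sum_distrib_left sum_distrib_right algebra_simps)
  also have "\<dots> = (\<Sum>b<q. \<Sum>i<N. \<Sum>a<q. 2 * (F $$ (i * q + a, r) * (S $$ (a, b) * v i $ b)))"
    by (rule sum.cong[OF refl], rule sum.swap)
  also have "\<dots> = (\<Sum>i<N. \<Sum>b<q. \<Sum>a<q. 2 * (F $$ (i * q + a, r) * (S $$ (a, b) * v i $ b)))"
    by (rule sum.swap)
  also have "\<dots> = (\<Sum>i<N. \<Sum>a<q. \<Sum>b<q. 2 * (F $$ (i * q + a, r) * (S $$ (a, b) * v i $ b)))"
    by (rule sum.cong[OF refl], rule sum.swap)
  also have "\<dots> = 2 * (\<Sum>i<N. \<Sum>a<q. F $$ (i * q + a, r) * (S *\<^sub>v v i) $ a)"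
  proof -
    have "(S *\<^sub>v v i) $ a = (\<Sum>b<q. S $$ (a, b) * v i $ b)" if "i < N" "a < q" for i a
      using S v[OF that(1)] that(2) by (auto simp: scalar_prod_def atLeast0LessThan)
    then show ?thesis by (simp add: sum_distrib_left)
  qed
  also have "(\<Sum>i<N. \<Sum>a<q. F $$ (i * q + a, r) * (S *\<^sub>v v i) $ a) =
    (\<Sum>k<N * q. F $$ (k, r) * stack q N (\<lambda>i. S *\<^sub>v v i) $ k)"
    unfolding sum_blocks
  proof (intro sum.cong refl)
    fix i a assume "i \<in> {..<N}" "a \<in> {..<q}"
    moreover from this have "i * q + a < N * q"
      by (simp add: block_index_less)
    ultimately show "F $$ (i * q + a, r) * (S *\<^sub>v v i) $ a =
      F $$ (i * q + a, r) * stack q N (\<lambda>i. S *\<^sub>v v i) $ (i * q + a)"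
      by (simp add: stack_def)
  qed
  also have "\<dots> = (F\<^sup>T *\<^sub>v stack q N (\<lambda>i. S *\<^sub>v v i)) $ r"
    using F r by (auto simp: scalar_prod_def stack_def atLeast0LessThan)
  finally show "(?K *\<^sub>v vectorize S) $ r =
    (2 \<cdot>\<^sub>v (F\<^sup>T *\<^sub>v (diag_block_mat (replicate N S) *\<^sub>v stack q N v))) $ r"
    using F r diag_block_mat_replicate_mult_stack[OF S v] by simp
qed (use F in \<open>auto simp: kron_data_def mat_sum_def\<close>)

section \<open>Half-vectorization and definiteness\<close>

lemma vech_carrier: "S \<in> carrier_mat k k \<Longrightarrow> vech S \<in> carrier_vec (k * (k + 1) div 2)"
  by (auto simp: vech_def vech_indices_props intro!: carrier_vecI)

lemma vectorize_index:
  assumes "S \<in> carrier_mat k k" "i < k" "j < k"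
  shows "vectorize S $ (j * k + i) = S $$ (i, j)"
proof -
  have "j * k + i < k * k"
    using assms(3,2) by (rule block_index_less)
  then show ?thesis using assms by (simp add: vectorize_def)
qed

text \<open>A duplication matrix is a linear left inverse of the passage from \<open>vectorize S\<close> to \<open>vech S\<close> on
  symmetric matrices, so a linear relation between half-vectorizations lifts to one between the
  matrices.\<close>

lemma vech_eq_smult_imp_eq_smult:
  fixes S S' :: "real mat"
  assumes S: "S \<in> carrier_mat k k" "S\<^sup>T = S" and S': "S' \<in> carrier_mat k k" "S'\<^sup>T = S'"
    and eq: "vech S = \<alpha> \<cdot>\<^sub>v vech S'"
  shows "S = \<alpha> \<cdot>\<^sub>m S'"
proof -
  obtain D where D: "duplication_mat k D" using duplication_mat_exists by blast
  then have Dc: "D \<in> carrier_mat (k * k) (k * (k + 1) div 2)" by (simp add: duplication_mat_def)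
  have "vectorize S = D *\<^sub>v (\<alpha> \<cdot>\<^sub>v vech S')"
    using D S eq by (metis duplication_mat_def)
  also have "\<dots> = \<alpha> \<cdot>\<^sub>v vectorize S'"
    using mult_mat_vec[OF Dc vech_carrier[OF S'(1)]] D S' by (simp add: duplication_mat_def)
  finally have vec: "vectorize S = \<alpha> \<cdot>\<^sub>v vectorize S'" .
  show ?thesis
  proof (rule eq_matI)
    fix i j assume "i < dim_row (\<alpha> \<cdot>\<^sub>m S')" "j < dim_col (\<alpha> \<cdot>\<^sub>m S')"
    then have ij: "i < k" "j < k" using S' by auto
    then have "j * k + i < k * k" by (simp add: block_index_less)
    then have "vectorize S $ (j * k + i) = \<alpha> * vectorize S' $ (j * k + i)"
      using vec S' by (simp add: vectorize_def)
    then show "S $$ (i, j) = (\<alpha> \<cdot>\<^sub>m S') $$ (i, j)"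
      using ij S S' by (simp add: vectorize_index)
  qed (use S S' in auto)
qed

text \<open>The quadratic forms of \<open>M\<close> and \<open>\<alpha> \<cdot>\<^sub>m M\<close> differ by the factor \<open>\<alpha>\<close> and are both positive at a unit
  vector; in dimension 0 there is no such vector, and \<open>\<alpha>\<close> is arbitrary.\<close>

lemma pos_def_smult_imp_pos:
  assumes M: "pos_def k M" and aM: "pos_def k (\<alpha> \<cdot>\<^sub>m M)" and k: "0 < k"
  shows "0 < \<alpha>"
proof -
  let ?e = "unit_vec k 0 :: real vec"
  have e: "?e \<in> carrier_vec k" "?e \<noteq> 0\<^sub>v k" using k by auto
  have Mc: "M \<in> carrier_mat k k" using M by (simp add: pos_def_def)
  have "(\<alpha> \<cdot>\<^sub>m M) *\<^sub>v ?e = \<alpha> \<cdot>\<^sub>v (M *\<^sub>v ?e)"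
    using Mc by (intro eq_vecI) auto
  moreover
  have "0 < ?e \<bullet> (M *\<^sub>v ?e)" "0 < ?e \<bullet> ((\<alpha> \<cdot>\<^sub>m M) *\<^sub>v ?e)"
    using M aM e by (auto simp: pos_def_def)
  moreover have "?e \<bullet> ((\<alpha> \<cdot>\<^sub>m M) *\<^sub>v ?e) = \<alpha> * (?e \<bullet> (M *\<^sub>v ?e))"
    using Mc calculation by simp
  ultimately show ?thesis by (simp add: zero_less_mult_iff)
qed

section \<open>One-dimensional kernels\<close>

text \<open>Both vectors are multiples of the single vector \<open>w\<close> of a basis of the kernel, and the coefficient
  of the nonzero vector \<open>v\<close> can be inverted.\<close>

lemma kernel_dim_one_imp_parallel:
  fixes A :: "'a::field mat"
  assumes dim: "kernel_dim A = 1" and u: "u \<in> mat_kernel A" and v: "v \<in> mat_kernel A"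
    and nz: "v \<noteq> 0\<^sub>v (dim_col A)"
  shows "\<exists>\<alpha>. u = \<alpha> \<cdot>\<^sub>v v"
proof -
  interpret kernel "dim_row A" "dim_col A" A by unfold_locales simp
  obtain Bs where Bs: "finite Bs" "basis Bs"
    using kernel_basis_exists[of A "dim_row A" "dim_col A"] by auto
  have "card Bs = 1" using Ker.dim_basis[OF Bs] dim by simp
  then obtain w where w: "Bs = {w}" by (auto simp: card_1_singleton_iff)
  have sub: "{w} \<subseteq> mat_kernel A" and span: "span {w} = mat_kernel A"
    using Bs(2) w by (auto simp: Ker.basis_def)
  have wc: "w \<in> carrier_vec (dim_col A)" using sub by (auto simp: mat_kernel_def)
  have mult: "\<exists>c. x = c \<cdot>\<^sub>v w" if x: "x \<in> mat_kernel A" for x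
  proof -
    from x span obtain c where c: "x = lincomb c {w}"
      using Ker.finite_in_span[of "{w}" x] sub by auto
    have "x = c w \<cdot>\<^sub>v w"
    proof (rule eq_vecI)
      fix i assume "i < dim_vec (c w \<cdot>\<^sub>v w)"
      then show "x $ i = (c w \<cdot>\<^sub>v w) $ i"
        using lincomb_index[OF _ sub, of i c] c wc by simp
    qed (use x wc in \<open>auto simp: mat_kernel_def\<close>)
    then show ?thesis by blast
  qed
  from mult[OF u] mult[OF v] obtain c d where cd: "u = c \<cdot>\<^sub>v w" "v = d \<cdot>\<^sub>v w" by blast
  with nz wc have "d \<noteq> 0" by auto
  with cd have "u = (c / d) \<cdot>\<^sub>v v" by (simp add: smult_smult_assoc)
  then show ?thesis by blast
qed

section \<open>The optimality equation as a kernel condition\<close>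

lemma past_rows_carrier:
  "past_rows q Tini N T v \<in> carrier_mat (Tini * q) (T - (Tini + N) + 1)"
  by (auto simp: past_rows_def row_range_def hankel_def)

lemma future_rows_carrier:
  "future_rows q Tini N T v \<in> carrier_mat (N * q) (T - (Tini + N) + 1)"
  by (auto simp: future_rows_def row_range_def hankel_def algebra_simps)

lemma past_data_carrier:
  "past_data m p Tini N T u y \<in> carrier_mat ((m + p) * Tini) (T - (Tini + N) + 1)"
proof -
  have "(m + p) * Tini = Tini * m + Tini * p" by (simp add: algebra_simps)
  then show ?thesis
    unfolding past_data_def by (simp only:) (intro carrier_append_rows past_rows_carrier)
qed

lemma Psi_tilde_carrier:
  assumes "duplication_mat m Dm" "duplication_mat p Dp"
  shows "Psi_tilde m p Tini N T ud yd ut yt Dm Dp \<in> carrier_mat (T - (Tini + N) + 1)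
    ((m + p) * Tini + (m * (m + 1) div 2 + p * (p + 1) div 2))"
  using assms past_data_carrier[of m p Tini N T ud yd]
  by (auto simp: Psi_tilde_def append_cols_def duplication_mat_def dim_diag_block_mat
      simp del: diag_block_mat.simps intro!: carrier_matI)

text \<open>The factor \<open>diag(I, D\<^sub>m, D\<^sub>p)\<close> expands the half-vectorizations to full vectorizations, on which the
  Kronecker blocks reproduce the two weighted terms of the optimality equation.\<close>

lemma Psi_tilde_mult_vec:
  assumes ut: "\<And>i. i < N \<Longrightarrow> ut i \<in> carrier_vec m" and yt: "\<And>i. i < N \<Longrightarrow> yt i \<in> carrier_vec p"
    and dup: "duplication_mat m Dm" "duplication_mat p Dp"
    and R: "R \<in> carrier_mat m m" "R\<^sup>T = R" and Q: "Q \<in> carrier_mat p p" "Q\<^sup>T = Q"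
    and lam: "lam \<in> carrier_vec ((m + p) * Tini)"
  shows "Psi_tilde m p Tini N T ud yd ut yt Dm Dp *\<^sub>v (lam @\<^sub>v vech R @\<^sub>v vech Q) =
    (past_data m p Tini N T ud yd)\<^sup>T *\<^sub>v lam
    + 2 \<cdot>\<^sub>v ((future_rows m Tini N T ud)\<^sup>T *\<^sub>v (diag_block_mat (replicate N R) *\<^sub>v stack m N ut))
    + 2 \<cdot>\<^sub>v ((future_rows p Tini N T yd)\<^sup>T *\<^sub>v (diag_block_mat (replicate N Q) *\<^sub>v stack p N yt))"
proof -
  let ?c = "T - (Tini + N) + 1" and ?l = "(m + p) * Tini"
  let ?W = "(past_data m p Tini N T ud yd)\<^sup>T"
  let ?U = "kron_data m N (future_rows m Tini N T ud) ut"
  let ?Y = "kron_data p N (future_rows p Tini N T yd) yt"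
  let ?E = "diag_block_mat [1\<^sub>m ?l, Dm, Dp]"
  let ?z = "lam @\<^sub>v vech R @\<^sub>v vech Q"
  have W: "?W \<in> carrier_mat ?c ?l" using past_data_carrier by (simp only: transpose_carrier_mat)
  have U: "?U \<in> carrier_mat ?c (m * m)" and Y: "?Y \<in> carrier_mat ?c (p * p)"
    by (rule kron_data_carrier, rule future_rows_carrier)+
  have Dm: "Dm \<in> carrier_mat (m * m) (m * (m + 1) div 2)" "Dm *\<^sub>v vech R = vectorize R"
    and Dp: "Dp \<in> carrier_mat (p * p) (p * (p + 1) div 2)" "Dp *\<^sub>v vech Q = vectorize Q"
    using dup R Q by (auto simp: duplication_mat_def)
  have vR: "vech R \<in> carrier_vec (m * (m + 1) div 2)" "vectorize R \<in> carrier_vec (m * m)"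
    and vQ: "vech Q \<in> carrier_vec (p * (p + 1) div 2)" "vectorize Q \<in> carrier_vec (p * p)"
    using R Q vech_carrier by (auto simp: vectorize_def)
  have E: "?E \<in> carrier_mat (?l + (m * m + p * p))
      (?l + (m * (m + 1) div 2 + p * (p + 1) div 2))"
    using Dm Dp by (auto simp: dim_diag_block_mat simp del: diag_block_mat.simps intro!: carrier_matI)
  have z: "?z \<in> carrier_vec (?l + (m * (m + 1) div 2 + p * (p + 1) div 2))"
    using lam vR vQ by (intro append_carrier_vec)
  have Dp1: "diag_block_mat [Dp] \<in> carrier_mat (p * p) (p * (p + 1) div 2)"
    using Dp by (simp only: diag_block_mat_singleton)
  have DmDp: "diag_block_mat [Dm, Dp] \<in> carrier_mat (m * m + p * p)
      (m * (m + 1) div 2 + p * (p + 1) div 2)"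
    using Dm Dp by (intro carrier_matI) (simp_all add: dim_diag_block_mat del: diag_block_mat.simps)
  \<comment> \<open>The block diagonal factor acts blockwise, and the duplication matrices turn \<open>vech\<close> into
    \<open>vectorize\<close>.\<close>
  have "?E *\<^sub>v ?z = 1\<^sub>m ?l *\<^sub>v lam @\<^sub>v (diag_block_mat [Dm, Dp] *\<^sub>v (vech R @\<^sub>v vech Q))"
    by (rule diag_block_mat_Cons_mult_vec[OF one_carrier_mat DmDp lam
          append_carrier_vec[OF vR(1) vQ(1)]])
  also have "diag_block_mat [Dm, Dp] *\<^sub>v (vech R @\<^sub>v vech Q)
      = Dm *\<^sub>v vech R @\<^sub>v (diag_block_mat [Dp] *\<^sub>v vech Q)"
    by (rule diag_block_mat_Cons_mult_vec[OF Dm(1) Dp1 vR(1) vQ(1)])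
  finally have Ez: "?E *\<^sub>v ?z = lam @\<^sub>v vectorize R @\<^sub>v vectorize Q"
    by (simp only: one_mult_mat_vec[OF lam] Dm(2) Dp(2) diag_block_mat_singleton)
  have "Psi_tilde m p Tini N T ud yd ut yt Dm Dp *\<^sub>v ?z =
    (?W @\<^sub>c ?U @\<^sub>c ?Y) *\<^sub>v (?E *\<^sub>v ?z)"
    unfolding Psi_tilde_def
    by (rule assoc_mult_mat_vec[OF append_cols_carrier[OF W append_cols_carrier[OF U Y]] E z])
  also have "\<dots> = ?W *\<^sub>v lam + (?U *\<^sub>v vectorize R + ?Y *\<^sub>v vectorize Q)"
    unfolding Ez
    using append_cols_mult_vec[OF W append_cols_carrier[OF U Y] lam append_carrier_vec[OF vR(2) vQ(2)]]
      append_cols_mult_vec[OF U Y vR(2) vQ(2)] by simp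
  also have "\<dots> = ?W *\<^sub>v lam + ?U *\<^sub>v vectorize R + ?Y *\<^sub>v vectorize Q"
    by (rule assoc_add_vec[symmetric, OF mult_mat_vec_carrier[OF W lam]
          mult_mat_vec_carrier[OF U vR(2)] mult_mat_vec_carrier[OF Y vQ(2)]])
  finally show ?thesis
    by (simp only: kron_data_mult_vectorize[OF future_rows_carrier ut R(1)]
        kron_data_mult_vectorize[OF future_rows_carrier yt Q(1)])
qed

lemma optimality_equation_imp_mat_kernel:
  assumes ut: "\<And>i. i < N \<Longrightarrow> ut i \<in> carrier_vec m" and yt: "\<And>i. i < N \<Longrightarrow> yt i \<in> carrier_vec p"
    and dup: "duplication_mat m Dm" "duplication_mat p Dp"
    and R: "R \<in> carrier_mat m m" "R\<^sup>T = R" and Q: "Q \<in> carrier_mat p p" "Q\<^sup>T = Q"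
    and lam: "lam \<in> carrier_vec ((m + p) * Tini)"
    and eq: "optimality_equation m p Tini N T ud yd ut yt Q R lam"
  shows "lam @\<^sub>v vech R @\<^sub>v vech Q \<in> mat_kernel (Psi_tilde m p Tini N T ud yd ut yt Dm Dp)"
proof (rule mat_kernelI[OF Psi_tilde_carrier[OF dup]])
  show "lam @\<^sub>v vech R @\<^sub>v vech Q
      \<in> carrier_vec ((m + p) * Tini + (m * (m + 1) div 2 + p * (p + 1) div 2))"
    by (intro append_carrier_vec lam vech_carrier R(1) Q(1))
  show "Psi_tilde m p Tini N T ud yd ut yt Dm Dp *\<^sub>v (lam @\<^sub>v vech R @\<^sub>v vech Q) =
      0\<^sub>v (T - (Tini + N) + 1)"
    by (rule trans[OF Psi_tilde_mult_vec eq[unfolded optimality_equation_def]])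
      (rule ut yt dup R Q lam | assumption)+
qed

text \<open>The output dimension is \<open>dim_row D\<close> because a sum of vectors takes the dimension of its second
  summand.\<close>

lemma trajectory_from_carrier:
  assumes "trajectory_from A B C D x0 T u y" "k < T"
  shows "u k \<in> carrier_vec (dim_col B)" "y k \<in> carrier_vec (dim_row D)"
proof -
  from assms(1) obtain x where u: "\<forall>k<T. u k \<in> carrier_vec (dim_col B)"
    and x: "\<forall>k<T. x (Suc k) = A *\<^sub>v x k + B *\<^sub>v u k \<and> y k = C *\<^sub>v x k + D *\<^sub>v u k"
    unfolding trajectory_from_def by (elim conjE exE)
  have "y k = C *\<^sub>v x k + D *\<^sub>v u k" using x[rule_format, OF assms(2)] by (rule conjunct2)
  then have "dim_vec (y k) = dim_row D" by (simp only: index_add_vec(2) dim_mult_mat_vec)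
  then show "y k \<in> carrier_vec (dim_row D)" by (rule carrier_vecI)
  show "u k \<in> carrier_vec (dim_col B)"
    using u[rule_format, OF assms(2)] .
qed

section \<open>Uniqueness of the weights up to scaling\<close>

theorem proposition3:
  fixes n m p Tini N T :: nat
    and A B C D Q0 R0 Q R Q' R' Dm Dp :: "real mat"
    and x0 :: "real vec"
    and ud yd uo yo ut yt :: "nat \<Rightarrow> real vec"
  assumes system: "minimal_lti n m p A B C D"
    and length: "Tini + N \<le> T"
    and offline_data: "io_trajectory A B C D T ud yd"
    and rank: "mat_rank (data_matrix m p Tini N T ud yd) = m * (Tini + N) + n"
    and true_weights: "pos_def p Q0" "pos_def m R0"
    and initial_state: "x0 \<in> carrier_vec n"
    and optimal_data: "lq_optimal A B C D x0 (Tini + N) Q0 R0 uo yo"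
    and last_samples: "ut = (\<lambda>i. uo (Tini + i))" "yt = (\<lambda>i. yo (Tini + i))"
    and duplication: "duplication_mat m Dm" "duplication_mat p Dp"
    and weights: "pos_def p Q" "pos_def m R"
    and weights': "pos_def p Q'" "pos_def m R'"
    and equation: "\<exists>lam \<in> carrier_vec ((m + p) * Tini).
      optimality_equation m p Tini N T ud yd ut yt Q R lam"
    and equation': "\<exists>lam \<in> carrier_vec ((m + p) * Tini).
      optimality_equation m p Tini N T ud yd ut yt Q' R' lam"
    and null_space: "kernel_dim (Psi_tilde m p Tini N T ud yd ut yt Dm Dp) = 1"
  shows "\<exists>\<alpha>>0. Q = \<alpha> \<cdot>\<^sub>m Q' \<and> R = \<alpha> \<cdot>\<^sub>m R'"
proof -
  have Q: "Q \<in> carrier_mat p p" "Q\<^sup>T = Q" and R: "R \<in> carrier_mat m m" "R\<^sup>T = R"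
    and Q': "Q' \<in> carrier_mat p p" "Q'\<^sup>T = Q'" and R': "R' \<in> carrier_mat m m" "R'\<^sup>T = R'"
    using weights weights' unfolding pos_def_def by blast+
  show ?thesis
  proof (cases "m = 0 \<and> p = 0")
    case True
    \<comment> \<open>All four weights are empty matrices here, and every scalar will do.\<close>
    then have q: "Q = 1 \<cdot>\<^sub>m Q'"
      using Q(1) Q'(1) by (intro eq_matI) simp_all
    have r: "R = 1 \<cdot>\<^sub>m R'"
      using R(1) R'(1) True by (intro eq_matI) simp_all
    show ?thesis using q r by (intro exI[of _ 1] conjI) simp
  next
    case False
    let ?Psi = "Psi_tilde m p Tini N T ud yd ut yt Dm Dp"
    have "lti_system n m p A B C D"
      using system unfolding minimal_lti_def by (rule conjunct1)
    then have sys: "dim_col B = m" "dim_row D = p"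
      by (auto simp: lti_system_def)
    have traj: "trajectory_from A B C D x0 (Tini + N) uo yo"
      using optimal_data unfolding lq_optimal_def by (rule conjunct1)
    have ut: "ut i \<in> carrier_vec m" and yt: "yt i \<in> carrier_vec p" if "i < N" for i
      using trajectory_from_carrier[OF traj, of "Tini + i"] that
      unfolding last_samples sys by simp_all
    obtain lam where lam: "lam \<in> carrier_vec ((m + p) * Tini)"
      "optimality_equation m p Tini N T ud yd ut yt Q R lam" using equation by blast
    obtain lam' where lam': "lam' \<in> carrier_vec ((m + p) * Tini)"
      "optimality_equation m p Tini N T ud yd ut yt Q' R' lam'" using equation' by blast
    let ?z = "lam @\<^sub>v vech R @\<^sub>v vech Q" and ?z' = "lam' @\<^sub>v vech R' @\<^sub>v vech Q'"
    have ker: "?z \<in> mat_kernel ?Psi"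
      by (rule optimality_equation_imp_mat_kernel[OF ut yt duplication R Q lam])
    have ker': "?z' \<in> mat_kernel ?Psi"
      by (rule optimality_equation_imp_mat_kernel[OF ut yt duplication R' Q' lam'])
    \<comment> \<open>Stated for an arbitrary first vector because it serves twice: with \<open>\<beta> = \<alpha>\<close> for the
      conclusion, and with \<open>\<beta> = 0\<close> and \<open>?z'\<close> itself to see that \<open>?z'\<close> is not zero.\<close>
    have scale: "S = \<beta> \<cdot>\<^sub>m R' \<and> P = \<beta> \<cdot>\<^sub>m Q'"
      if S: "S \<in> carrier_mat m m" "S\<^sup>T = S" and P: "P \<in> carrier_mat p p" "P\<^sup>T = P"
        and l: "l \<in> carrier_vec ((m + p) * Tini)"
        and eq: "l @\<^sub>v vech S @\<^sub>v vech P = \<beta> \<cdot>\<^sub>v ?z'" for \<beta> S P l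
    proof -
      have "vech S @\<^sub>v vech P = \<beta> \<cdot>\<^sub>v vech R' @\<^sub>v \<beta> \<cdot>\<^sub>v vech Q'"
        using eq append_vec_eq[OF l smult_carrier_vec[THEN iffD2, OF lam'(1)]]
        by (simp add: smult_append_vec)
      then have "vech S = \<beta> \<cdot>\<^sub>v vech R'" "vech P = \<beta> \<cdot>\<^sub>v vech Q'"
        using append_vec_eq[OF vech_carrier[OF S(1)]
            smult_carrier_vec[THEN iffD2, OF vech_carrier[OF R'(1)]]] by auto
      then show ?thesis using vech_eq_smult_imp_eq_smult S P R' Q' by blast
    qed
    have pos: "0 < \<beta>" if "pos_def m (\<beta> \<cdot>\<^sub>m R')" "pos_def p (\<beta> \<cdot>\<^sub>m Q')" for \<beta>
      using False pos_def_smult_imp_pos[OF weights'(2) that(1)]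
        pos_def_smult_imp_pos[OF weights'(1) that(2)] by auto
    have "?z' \<noteq> 0\<^sub>v (dim_col ?Psi)"
    proof
      assume z': "?z' = 0\<^sub>v (dim_col ?Psi)"
      have "0 \<cdot>\<^sub>v ?z' = 0\<^sub>v (dim_col ?Psi)" unfolding z' by (rule eq_vecI) auto
      with z' have "?z' = 0 \<cdot>\<^sub>v ?z'" by (rule trans[OF _ sym])
      from scale[OF R' Q' lam'(1) this] pos[of 0] weights' show False by (metis less_irrefl)
    qed
    with kernel_dim_one_imp_parallel[OF null_space ker ker'] obtain \<alpha> where "?z = \<alpha> \<cdot>\<^sub>v ?z'" by blast
    from scale[OF R Q lam(1) this] have "R = \<alpha> \<cdot>\<^sub>m R'" "Q = \<alpha> \<cdot>\<^sub>m Q'" by auto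
    with pos[of \<alpha>] weights show ?thesis by blast
  qed
qed

end
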